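(* Let $(V,E)$ be a finite simple graph and let $g:V\to\mathbb{R}$ be a coloring, i.e. $g(v)\ne g(w)$ whenever $(v,w)\in E$. Then for every $v\in V$, $$j_g(v)=1-\frac{\chi(S(v))}{2}-\frac{\chi(S_g(v))}{2}.$$
   Context: The Euler characteristic $\chi$ of a finite simple graph is $\sum_x(-1)^{\dim(x)}$ over all its non-empty cliques $x$, a clique with $k+1$ vertices having dimension $k$ (empty graph: $0$). $S(v)$ is the subgraph induced by the neighbors of $v$. $S^-_g(v)$ is the subgraph of $S(v)$ induced by $\{w\in S(v): g(w)<g(v)\}$, the index is $i_g(v)=1-\chi(S_g^-(v))$, and the symmetric index is $j_g(v)=[i_g(v)+i_{-g}(v)]/2$. The level set $S_g(v)$ is the graph whose vertices are the non-empty cliques $x$ of $S(v)$ on which $w\mapsto \mathrm{sign}(g(w)-g(v))$ takes both values $-1$ and $1$, two distinct such cliques $a,b$ being adjacent iff $a\subset b$ or $b\subset a$. *)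

theory Defs
  imports Complex_Main "Graph_Theory.Graph_Theory"
begin

text \<open>
  A finite simple graph is a \<^term>\<open>G\<close> satisfying the locale predicate \<^locale>\<open>graph\<close>: a finite
  symmetric digraph without loops and without parallel arcs, so that an undirected edge is a
  pair of opposite arcs. Adjacency is \<^term>\<open>u \<rightarrow>\<^bsub>G\<^esub> w\<close>.
\<close>

definition cliques :: "('a, 'b) pre_digraph \<Rightarrow> 'a set set" where
  "cliques G = {x. x \<subseteq> verts G \<and> x \<noteq> {} \<and> (\<forall>u\<in>x. \<forall>w\<in>x. u \<noteq> w \<longrightarrow> u \<rightarrow>\<^bsub>G\<^esub> w)}"

definition clique_dim :: "'a set \<Rightarrow> nat" where
  "clique_dim x = card x - 1"

definition euler_char :: "('a, 'b) pre_digraph \<Rightarrow> int" where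
  "euler_char G = (\<Sum>x\<in>cliques G. (-1) ^ clique_dim x)"

definition unit_sphere :: "('a, 'b) pre_digraph \<Rightarrow> 'a \<Rightarrow> ('a, 'b) pre_digraph" where
  "unit_sphere G v = G \<restriction> {w. v \<rightarrow>\<^bsub>G\<^esub> w}"

definition lower_sphere ::
  "('a, 'b) pre_digraph \<Rightarrow> ('a \<Rightarrow> real) \<Rightarrow> 'a \<Rightarrow> ('a, 'b) pre_digraph" where
  "lower_sphere G g v = unit_sphere G v \<restriction> {w \<in> verts (unit_sphere G v). g w < g v}"

definition index :: "('a, 'b) pre_digraph \<Rightarrow> ('a \<Rightarrow> real) \<Rightarrow> 'a \<Rightarrow> int" where
  "index G g v = 1 - euler_char (lower_sphere G g v)"

definition sym_index :: "('a, 'b) pre_digraph \<Rightarrow> ('a \<Rightarrow> real) \<Rightarrow> 'a \<Rightarrow> real" where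
  "sym_index G g v = (index G g v + index G (\<lambda>w. - g w) v) / 2"

definition level_cliques ::
  "('a, 'b) pre_digraph \<Rightarrow> ('a \<Rightarrow> real) \<Rightarrow> 'a \<Rightarrow> 'a set set" where
  "level_cliques G g v =
    {x \<in> cliques (unit_sphere G v). {-1, 1} \<subseteq> (\<lambda>w. sgn (g w - g v)) ` x}"

definition level_set ::
  "('a, 'b) pre_digraph \<Rightarrow> ('a \<Rightarrow> real) \<Rightarrow> 'a \<Rightarrow> 'a set pair_pre_digraph" where
  "level_set G g v =
    \<lparr>pverts = level_cliques G g v,
     parcs = {(a, b). a \<in> level_cliques G g v \<and> b \<in> level_cliques G g v \<and> (a \<subset> b \<or> b \<subset> a)}\<rparr>"

definition coloring :: "('a, 'b) pre_digraph \<Rightarrow> ('a \<Rightarrow> real) \<Rightarrow> bool" where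
  "coloring G g \<longleftrightarrow> (\<forall>v w. v \<rightarrow>\<^bsub>G\<^esub> w \<longrightarrow> g v \<noteq> g w)"

lemma finite_cliques:
  assumes "finite (verts G)"
  shows "finite (cliques G)"
  by (rule finite_subset[of _ "Pow (verts G)"]) (use assms in \<open>auto simp: cliques_def\<close>)

lemma (in wf_digraph) unit_sphere_verts_subset: "verts (unit_sphere G v) \<subseteq> verts G"
  by (auto simp: unit_sphere_def dest: adj_in_verts)

lemma (in graph) pair_graph_level_set: "pair_graph (level_set G g v)"
proof -
  have "finite (verts (unit_sphere G v))"
    using unit_sphere_verts_subset finite_verts by (rule finite_subset)
  then have fin: "finite (level_cliques G g v)"
    by (simp add: level_cliques_def finite_cliques)
  have "finite (parcs (level_set G g v))"
    by (rule finite_subset[of _ "level_cliques G g v \<times> level_cliques G g v"])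
      (use fin in \<open>auto simp: level_set_def\<close>)
  with fin show ?thesis
    by unfold_locales (auto simp: level_set_def symmetric_def sym_def)
qed

end

(* A nonempty clique of S(v) lies below v, above v, or is mixed, so the Euler characteristic of
   S(v) is that of the lower sphere plus that of the upper sphere plus the sum of
   (-1)^(|x| - 1) over the mixed cliques x. The level set is the comparability graph of the poset
   of mixed cliques, and its cliques are the nonempty chains. Sorting chains by their greatest
   element x gives 1 - chi(elements below x) for each x, and since the sum of (-1)^|y| over the
   mixed subsets y of a mixed clique x equals 1, induction shows this difference to be (-1)^|x|.
   So the Euler characteristic of the level set is the sum of (-1)^|x| over mixed x. *)

theory Submission
  imports Defs
begin

text \<open>The simplices of the order complex of \<open>L\<close>. The type is generic; on sets,
  \<open><\<close> is strict inclusion.\<close>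

definition order_chains :: "'c::order set \<Rightarrow> 'c set set" where
  "order_chains L = {C. C \<subseteq> L \<and> C \<noteq> {} \<and> (\<forall>a\<in>C. \<forall>b\<in>C. a \<noteq> b \<longrightarrow> a < b \<or> b < a)}"

lemma finite_order_chains: "finite L \<Longrightarrow> finite (order_chains L)"
  by (rule finite_subset[of _ "Pow L"]) (auto simp: order_chains_def)

text \<open>Within a chain, comparability turns a maximal element into the greatest one.\<close>

lemma order_chain_has_greatest:
  assumes "finite L" "C \<in> order_chains L"
  obtains x where "x \<in> C" "\<And>y. y \<in> C \<Longrightarrow> y \<noteq> x \<Longrightarrow> y < x"
proof -
  have "finite C" "C \<noteq> {}"
    using assms by (auto simp: order_chains_def intro: finite_subset)
  then obtain x where "x \<in> C" "\<forall>b\<in>C. x \<le> b \<longrightarrow> x = b"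
    using finite_has_maximal by blast
  with assms(2) have "y < x" if "y \<in> C" "y \<noteq> x" for y
    using that \<open>x \<in> C\<close> unfolding order_chains_def by (blast dest: less_imp_le)
  with \<open>x \<in> C\<close> show thesis using that by blast
qed

lemma bij_betw_chain_insert_greatest:
  assumes "finite L"
  shows "bij_betw (\<lambda>(x, D). insert x D)
    (SIGMA x:L. insert {} (order_chains {y \<in> L. y < x})) (order_chains L)"
proof (rule bij_betwI')
  fix p q
  assume "p \<in> (SIGMA x:L. insert {} (order_chains {y \<in> L. y < x}))"
    and "q \<in> (SIGMA x:L. insert {} (order_chains {y \<in> L. y < x}))"
  then obtain x D y E where p: "p = (x, D)" and q: "q = (y, E)"
    and D: "\<forall>d\<in>D. d < x" and E: "\<forall>e\<in>E. e < y"
    by (force simp: order_chains_def)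
  show "((case p of (x, D) \<Rightarrow> insert x D) = (case q of (x, D) \<Rightarrow> insert x D)) = (p = q)"
  proof
    assume "(case p of (x, D) \<Rightarrow> insert x D) = (case q of (x, D) \<Rightarrow> insert x D)"
    then have eq: "insert x D = insert y E" by (simp add: p q)
    \<comment> \<open>Otherwise \<open>x\<close> would lie in \<open>E\<close> and \<open>y\<close>
      in \<open>D\<close>, so \<open>x < y\<close> and \<open>y < x\<close>.\<close>
    then have "x = y"
      using D E by (metis insert_iff order_less_asym)
    moreover have "x \<notin> D" "y \<notin> E" using D E by auto
    ultimately show "p = q" using eq p q insert_ident by metis
  qed simp
next
  fix p
  assume "p \<in> (SIGMA x:L. insert {} (order_chains {y \<in> L. y < x}))"
  then show "(case p of (x, D) \<Rightarrow> insert x D) \<in> order_chains L"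
    by (auto simp: order_chains_def)
next
  fix C assume C: "C \<in> order_chains L"
  then obtain x where x: "x \<in> C" "\<And>y. y \<in> C \<Longrightarrow> y \<noteq> x \<Longrightarrow> y < x"
    using order_chain_has_greatest[OF assms] by metis
  have "(x, C - {x}) \<in> (SIGMA x:L. insert {} (order_chains {y \<in> L. y < x}))"
    using C x by (auto simp: order_chains_def)
  moreover have "C = (case (x, C - {x}) of (x, D) \<Rightarrow> insert x D)"
    using x by auto
  ultimately show "\<exists>p\<in>SIGMA x:L. insert {} (order_chains {y \<in> L. y < x}).
      C = (case p of (x, D) \<Rightarrow> insert x D)"
    by blast
qed

text \<open>Placing \<open>x\<close> on top of a nonempty chain raises the dimension by one and
  flips the sign; the summand 1 is the chain \<open>{x}\<close>.\<close>

lemma sum_order_chains_by_greatest: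
  fixes L :: "'c::order set"
  assumes "finite L"
  shows "(\<Sum>C\<in>order_chains L. (-1::int) ^ (card C - 1)) =
    (\<Sum>x\<in>L. 1 - (\<Sum>D\<in>order_chains {y \<in> L. y < x}. (-1) ^ (card D - 1)))"
proof -
  let ?below = "\<lambda>x. order_chains {y \<in> L. y < x}"
  have fin: "finite (?below x)" for x
    using assms by (simp add: finite_order_chains)
  have "(\<Sum>C\<in>order_chains L. (-1::int) ^ (card C - 1)) =
      (\<Sum>(x, D)\<in>(SIGMA x:L. insert {} (?below x)). (-1) ^ (card (insert x D) - 1))"
    by (subst sum.reindex_bij_betw[OF bij_betw_chain_insert_greatest[OF assms], symmetric])
      (simp add: case_prod_unfold)
  also have "\<dots> = (\<Sum>x\<in>L. \<Sum>D\<in>insert {} (?below x). (-1) ^ (card (insert x D) - 1))"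
    using assms fin by (subst sum.Sigma) auto
  also have "\<dots> = (\<Sum>x\<in>L. 1 - (\<Sum>D\<in>?below x. (-1) ^ (card D - 1)))"
  proof (rule sum.cong[OF refl])
    fix x
    have "(-1::int) ^ (card (insert x D) - 1) = - ((-1) ^ (card D - 1))"
      if D: "D \<in> ?below x" for D
    proof -
      have "x \<notin> D" "finite D" "D \<noteq> {}"
        using D assms by (auto simp: order_chains_def intro: finite_subset)
      \<comment> \<open>Nonemptiness of \<open>D\<close> matters because \<open>card D - 1\<close>
        is truncated at 0.\<close>
      then have "card (insert x D) - 1 = Suc (card D - 1)"
        by (simp add: card_gt_0_iff)
      then show ?thesis by simp
    qed
    moreover have "{} \<notin> ?below x" by (simp add: order_chains_def)
    ultimately show "(\<Sum>D\<in>insert {} (?below x). (-1::int) ^ (card (insert x D) - 1)) =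
        1 - (\<Sum>D\<in>?below x. (-1) ^ (card D - 1))"
      using fin by (simp add: sum_negf)
  qed
  finally show ?thesis .
qed

text \<open>The hypothesis determines \<open>w\<close> recursively: \<open>w x\<close> is 1 minus
  the total weight strictly below \<open>x\<close>, which by induction is the chain sum
  there.\<close>

lemma sum_order_chains_eq_sum_weight:
  fixes w :: "'c::order \<Rightarrow> int"
  assumes "finite L" and "\<And>x. x \<in> L \<Longrightarrow> (\<Sum>y | y \<in> L \<and> y \<le> x. w y) = 1"
  shows "(\<Sum>C\<in>order_chains L. (-1) ^ (card C - 1)) = (\<Sum>x\<in>L. w x)"
  using assms
proof (induction L rule: finite_psubset_induct)
  case (psubset L)
  have "(\<Sum>D\<in>order_chains {y \<in> L. y < x}. (-1) ^ (card D - 1)) = 1 - w x" if x: "x \<in> L" for x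
  proof -
    have "(\<Sum>D\<in>order_chains {y \<in> L. y < x}. (-1) ^ (card D - 1)) = sum w {y \<in> L. y < x}"
    proof (rule psubset.IH)
      fix z assume z: "z \<in> {y \<in> L. y < x}"
      \<comment> \<open>By transitivity everything below \<open>z\<close> is below \<open>x\<close>,
        so the hypothesis passes to the smaller set.\<close>
      then have "{y. y \<in> {y \<in> L. y < x} \<and> y \<le> z} = {y. y \<in> L \<and> y \<le> z}" by auto
      with z psubset.prems show "(\<Sum>y | y \<in> {y \<in> L. y < x} \<and> y \<le> z. w y) = 1" by simp
    qed (use x in auto)
    moreover have "{y. y \<in> L \<and> y \<le> x} = insert x {y \<in> L. y < x}" using x by auto
    ultimately show ?thesis using psubset.prems[OF x] psubset.hyps by simp
  qed
  then show ?case
    by (simp add: sum_order_chains_by_greatest[OF psubset.hyps(1)] del: One_nat_def)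
qed

text \<open>The sum expands the product of \<open>1 - 1\<close> over \<open>A\<close>.\<close>

lemma sum_Pow_alternating:
  assumes "finite A" "A \<noteq> {}"
  shows "(\<Sum>X\<in>Pow A. (-1::int) ^ card X) = 0"
  using prod_diff_conv_sum[of A "\<lambda>_. 1::int" "\<lambda>_. 1"] assms
  by (simp add: card_eq_0_iff power_0_left)

text \<open>Remove from all subsets those inside \<open>A\<close> or inside \<open>B\<close>. All
  three power sets sum to 0; the 1 comes from \<open>{}\<close>, the only set in both
  \<open>Pow A\<close> and \<open>Pow B\<close>.\<close>

lemma sum_mixed_subsets_alternating:
  assumes "finite A" "finite B" "A \<noteq> {}" "B \<noteq> {}" "A \<inter> B = {}"
  shows "(\<Sum>X | X \<subseteq> A \<union> B \<and> X \<inter> A \<noteq> {} \<and> X \<inter> B \<noteq> {}. (-1::int) ^ card X) = 1"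
proof -
  have eq: "{X. X \<subseteq> A \<union> B \<and> X \<inter> A \<noteq> {} \<and> X \<inter> B \<noteq> {}} = Pow (A \<union> B) - (Pow A \<union> Pow B)"
    using assms(5) by blast
  have int: "Pow A \<inter> Pow B = {{}}" using assms(5) by blast
  have "(\<Sum>X\<in>Pow A \<union> Pow B. (-1::int) ^ card X) = -1"
    using assms by (subst sum_Un) (simp_all add: sum_Pow_alternating int)
  moreover have "(\<Sum>X\<in>Pow (A \<union> B). (-1::int) ^ card X) = 0"
    using assms by (intro sum_Pow_alternating) auto
  moreover have "Pow A \<union> Pow B \<subseteq> Pow (A \<union> B)" by auto
  ultimately show ?thesis
    unfolding eq using assms by (subst sum_diff) auto
qed

text \<open>The vertex set of \<open>G \<restriction> U\<close> is \<open>U\<close> itself, so the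
  hypothesis keeps vertices outside \<open>G\<close> from forming singleton cliques.\<close>

lemma cliques_induce_subgraph:
  assumes "U \<subseteq> verts G"
  shows "cliques (G \<restriction> U) = {x \<in> cliques G. x \<subseteq> U}"
proof -
  have "u \<rightarrow>\<^bsub>G \<restriction> U\<^esub> w \<longleftrightarrow> u \<rightarrow>\<^bsub>G\<^esub> w \<and> u \<in> U \<and> w \<in> U" for u w
    by (auto simp: arcs_ends_conv induce_subgraph_def)
  with assms show ?thesis by (fastforce simp: cliques_def)
qed

lemma level_cliques_iff:
  "level_cliques G g v =
    {x \<in> cliques (unit_sphere G v). (\<exists>w\<in>x. g w < g v) \<and> (\<exists>w\<in>x. g v < g w)}"
proof -
  have "-1 = sgn (g w - g v) \<longleftrightarrow> g w < g v" "1 = sgn (g w - g v) \<longleftrightarrow> g v < g w" for w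
    by (auto simp: sgn_if)
  then show ?thesis by (simp add: level_cliques_def image_iff)
qed

text \<open>Adjacency in the level set is strict inclusion in either direction, that is,
  comparability in the order on sets.\<close>

lemma cliques_level_set: "cliques (with_proj (level_set G g v)) = order_chains (level_cliques G g v)"
  by (auto simp: cliques_def order_chains_def level_set_def)

context
  fixes G :: "('a, 'b) pre_digraph" and g :: "'a \<Rightarrow> real" and v :: 'a
  assumes graph: "graph G" and coloring: "coloring G g"
begin

lemma finite_unit_sphere: "finite (verts (unit_sphere G v))"
proof -
  interpret graph G by (rule graph)
  show ?thesis using unit_sphere_verts_subset finite_verts by (rule finite_subset)
qed

lemma coloring_unit_sphere: "w \<in> verts (unit_sphere G v) \<Longrightarrow> g w \<noteq> g v"
  using coloring unfolding coloring_def unit_sphere_def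
  by (metis induce_subgraph_verts mem_Collect_eq)

lemma clique_unit_sphereD:
  assumes "x \<in> cliques (unit_sphere G v)"
  shows "finite x" "x \<noteq> {}" "\<And>w. w \<in> x \<Longrightarrow> g w \<noteq> g v"
  using assms finite_unit_sphere coloring_unit_sphere
  by (auto simp: cliques_def intro: finite_subset)

lemma finite_level_cliques: "finite (level_cliques G g v)"
  by (simp add: level_cliques_def finite_cliques finite_unit_sphere)

text \<open>Nonempty subsets of a clique are cliques, so the sum runs over the subsets of
  \<open>x\<close> that meet both its lower and its upper part. This is the weight condition of
  \<open>sum_order_chains_eq_sum_weight\<close>.\<close>

lemma sum_level_cliques_below:
  assumes "x \<in> level_cliques G g v"
  shows "(\<Sum>y | y \<in> level_cliques G g v \<and> y \<subseteq> x. (-1::int) ^ card y) = 1"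
proof -
  let ?A = "{w \<in> x. g w < g v}" and ?B = "{w \<in> x. g v < g w}"
  have x: "x \<in> cliques (unit_sphere G v)" using assms by (simp add: level_cliques_def)
  \<comment> \<open>By the coloring hypothesis no vertex of \<open>x\<close> has the value
    \<open>g v\<close>.\<close>
  have un: "x = ?A \<union> ?B"
    using clique_unit_sphereD(3)[OF x] by (auto simp: neq_iff)
  have sub: "y \<in> cliques (unit_sphere G v)" if "y \<subseteq> x" "w \<in> y" for y w
    using that x by (auto simp: cliques_def)
  have "y \<in> level_cliques G g v \<and> y \<subseteq> x \<longleftrightarrow>
      y \<subseteq> x \<and> (\<exists>w\<in>y. g w < g v) \<and> (\<exists>w\<in>y. g v < g w)" for y
    unfolding level_cliques_iff using sub by blast
  moreover have "y \<subseteq> x \<and> (\<exists>w\<in>y. g w < g v) \<and> (\<exists>w\<in>y. g v < g w) \<longleftrightarrow>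
      y \<subseteq> x \<and> y \<inter> ?A \<noteq> {} \<and> y \<inter> ?B \<noteq> {}" for y
    by blast
  ultimately have "{y. y \<in> level_cliques G g v \<and> y \<subseteq> x} =
      {y. y \<subseteq> ?A \<union> ?B \<and> y \<inter> ?A \<noteq> {} \<and> y \<inter> ?B \<noteq> {}}"
    by (simp only: un[symmetric])
  moreover have "(\<Sum>y | y \<subseteq> ?A \<union> ?B \<and> y \<inter> ?A \<noteq> {} \<and> y \<inter> ?B \<noteq> {}. (-1::int) ^ card y) = 1"
    using assms clique_unit_sphereD(1)[OF x]
    by (intro sum_mixed_subsets_alternating) (auto simp: level_cliques_iff)
  ultimately show ?thesis by simp
qed

text \<open>The weight is \<open>(-1) ^ card x\<close>, opposite in sign to the contribution of
  \<open>x\<close> to the Euler characteristic of the sphere.\<close>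

lemma euler_char_level_set:
  "euler_char (with_proj (level_set G g v)) = (\<Sum>x\<in>level_cliques G g v. (-1) ^ card x)"
  unfolding euler_char_def cliques_level_set clique_dim_def
  by (rule sum_order_chains_eq_sum_weight[OF finite_level_cliques sum_level_cliques_below])

lemma euler_char_unit_sphere:
  "euler_char (unit_sphere G v) =
    euler_char (lower_sphere G g v) + euler_char (lower_sphere G (\<lambda>w. - g w) v)
      - euler_char (with_proj (level_set G g v))"
proof -
  let ?S = "unit_sphere G v"
  let ?N = "cliques (lower_sphere G g v)" and ?P = "cliques (lower_sphere G (\<lambda>w. - g w) v)"
    and ?M = "level_cliques G g v"
  have N: "?N = {x \<in> cliques ?S. \<forall>w\<in>x. g w < g v}"
    unfolding lower_sphere_def by (subst cliques_induce_subgraph) (auto simp: cliques_def)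
  \<comment> \<open>Negating \<open>g\<close> reverses the comparison, so the lower sphere of
    \<open>-g\<close> is the upper part.\<close>
  have P: "?P = {x \<in> cliques ?S. \<forall>w\<in>x. g v < g w}"
    unfolding lower_sphere_def by (subst cliques_induce_subgraph) (auto simp: cliques_def)
  have un: "cliques ?S = (?N \<union> ?P) \<union> ?M"
    unfolding N P level_cliques_iff
    using clique_unit_sphereD(3) by (auto simp: neq_iff)
  have fin: "finite (cliques ?S)" by (simp add: finite_cliques finite_unit_sphere)
  have "finite ?N" "finite ?P" using fin by (simp_all add: N P)
  \<comment> \<open>The first disjointness rests on cliques being nonempty.\<close>
  moreover have "?N \<inter> ?P = {}" "(?N \<union> ?P) \<inter> ?M = {}"
    unfolding N P level_cliques_iff using clique_unit_sphereD(2) by fastforce+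
  ultimately have "euler_char ?S = euler_char (lower_sphere G g v)
      + euler_char (lower_sphere G (\<lambda>w. - g w) v) + (\<Sum>x\<in>?M. (-1) ^ clique_dim x)"
    unfolding euler_char_def
    by (subst un) (simp add: sum.union_disjoint finite_level_cliques)
  moreover have "(-1::int) ^ clique_dim x = - ((-1) ^ card x)" if "x \<in> ?M" for x
  proof -
    have "card x > 0"
      using that clique_unit_sphereD(1,2) by (simp add: level_cliques_def card_gt_0_iff)
    then show ?thesis by (cases "card x") (simp_all add: clique_dim_def)
  qed
  ultimately show ?thesis by (simp add: euler_char_level_set sum_negf)
qed

end

theorem mainTheorem12:
  fixes G :: "('a, 'b) pre_digraph" and g :: "'a \<Rightarrow> real" and v :: 'a
  assumes "graph G"
    and "coloring G g"
    and "v \<in> verts G"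
  shows "sym_index G g v =
    1 - real_of_int (euler_char (unit_sphere G v)) / 2
      - real_of_int (euler_char (with_proj (level_set G g v))) / 2"
  \<comment> \<open>The symmetric index is 1 minus half the sum of the two lower-sphere
    characteristics; this identity evaluates that sum.\<close>
  using euler_char_unit_sphere[OF assms(1,2), of v]
  by (simp add: sym_index_def index_def field_simps)

end
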